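(* Suppose that a $\frac{\pi}{3}$-equiangular unit equilateral hexagon $\mathcal P=(P_0,\dots,P_5)$ in $\mathbb R^3$ is parametrized by angles $\varphi_1,\varphi_3,\varphi_5$ (taken modulo $2\pi$) via $$P_0=(-S,0,0),\quad P_2=(S,0,0),\quad P_4=(0,\sqrt3\,S,0),$$ $$P_1=\big(0,\,-C\cos\varphi_1,\,C\sin\varphi_1\big),$$ $$P_3=\Big(\tfrac12S+\tfrac{\sqrt3}{2}C\cos\varphi_3,\ \tfrac{\sqrt3}{2}S+\tfrac12C\cos\varphi_3,\ C\sin\varphi_3\Big),$$ $$P_5=\Big(-\tfrac12S-\tfrac{\sqrt3}{2}C\cos\varphi_5,\ \tfrac{\sqrt3}{2}S+\tfrac12C\cos\varphi_5,\ C\sin\varphi_5\Big),$$ where $C=\cos\frac{\pi}{6}=\frac{\sqrt3}{2}$ and $S=\sin\frac{\pi}{6}=\frac12$. Then, as multisets, $$\{\varphi_1,\varphi_3,\varphi_5\}=\{\pi,\varphi,f(\varphi)\},\quad \{\pi,\pi,\varphi\},\quad\text{or}\quad \left\{\pm\arccos\tfrac13,\ \pm\arccos\tfrac13,\ \pm\arccos\tfrac13\right\}$$ (with the same sign for all three entries in the last case), where $\varphi$ is arbitrary (that is, every value of $\varphi$ modulo $2\pi$ occurs). The first case contains a boat, when $\{\varphi_1,\varphi_3,\varphi_5\}=\{\pi,\pm\arccos\frac13,\pm\arccos\frac13\}$ (same signs), and the last triples correspond to a chair.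
   Context: Indices of vertices are modulo $6$. A $\theta$-equiangular unit equilateral hexagon is a $6$-tuple $(P_0,\dots,P_5)$ of points of $\mathbb R^3$ with $|P_i-P_{i+1}|=1$ and $\angle P_{i-1}P_iP_{i+1}=\theta$ for all $i$ modulo $6$; intersections of edges and coincidences of vertices are allowed. The function $f$ (from angles modulo $2\pi$ to angles modulo $2\pi$) is defined for $\varphi\not\equiv\pi$ by $$(\cos f(\varphi),\ \sin f(\varphi))=\left(\frac{-(\cos\varphi+1)^2+4\sin^2\varphi}{(\cos\varphi+1)^2+4\sin^2\varphi},\ \frac{4\sin\varphi(\cos\varphi+1)}{(\cos\varphi+1)^2+4\sin^2\varphi}\right),$$ and by $f(\pi)=0$. Boat and chair: an equiangular unit equilateral hexagon is called a boat (resp. a chair) if for some $i$ one has $\overrightarrow{P_{i-1}P_{i-2}}=\overrightarrow{P_{i+1}P_{i+2}}$, the four points $P_{i-1},P_{i+1},P_{i+2},P_{i-2}$ being the vertices of a non-degenerate parallelogram, and the points $P_i$ and $P_{i+3}$ lie strictly on the same side (resp. strictly on opposite sides) of the plane containing these four points. *)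

theory Defs
  imports "HOL-Analysis.Analysis" "HOL-Library.Real_Mod" "HOL-Library.Multiset"
begin

quotient_type angle = real / "\<lambda>x y. [x = y] (rmod (2 * pi))"
  morphisms rep_angle ang
  by (intro equivpI reflpI sympI transpI) (auto intro: rcong_sym rcong_trans)

lift_definition cos_angle :: "angle \<Rightarrow> real" is cos
  by (metis cos_rmod rcong_def)

lift_definition sin_angle :: "angle \<Rightarrow> real" is sin
  by (rule sin_rcong)

lemma angle_eq_iff:
  "\<psi> = \<omega> \<longleftrightarrow> cos_angle \<psi> = cos_angle \<omega> \<and> sin_angle \<psi> = sin_angle \<omega>"
  by transfer (simp add: cis_eq_iff [symmetric] complex_eq_iff)

text \<open>
  The description operator is justified by the lemma \<open>f_angle_unique_existence\<close> below: the pair on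
  the right-hand side is a point of the unit circle whenever \<open>\<phi> \<noteq> ang pi\<close>.
\<close>

definition f_angle :: "angle \<Rightarrow> angle" where
  "f_angle \<phi> =
     (if \<phi> = ang pi then ang 0
      else THE \<psi>. (cos_angle \<psi>, sin_angle \<psi>) =
        ((- (cos_angle \<phi> + 1)\<^sup>2 + 4 * (sin_angle \<phi>)\<^sup>2) / ((cos_angle \<phi> + 1)\<^sup>2 + 4 * (sin_angle \<phi>)\<^sup>2),
         4 * sin_angle \<phi> * (cos_angle \<phi> + 1) / ((cos_angle \<phi> + 1)\<^sup>2 + 4 * (sin_angle \<phi>)\<^sup>2)))"

lemma f_angle_unique_existence:
  assumes "\<phi> \<noteq> ang pi"
  shows "\<exists>!\<psi>. (cos_angle \<psi>, sin_angle \<psi>) =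
        ((- (cos_angle \<phi> + 1)\<^sup>2 + 4 * (sin_angle \<phi>)\<^sup>2) / ((cos_angle \<phi> + 1)\<^sup>2 + 4 * (sin_angle \<phi>)\<^sup>2),
         4 * sin_angle \<phi> * (cos_angle \<phi> + 1) / ((cos_angle \<phi> + 1)\<^sup>2 + 4 * (sin_angle \<phi>)\<^sup>2))"
proof -
  define c s where "c = cos_angle \<phi>" and "s = sin_angle \<phi>"
  define D where "D = (c + 1)\<^sup>2 + 4 * s\<^sup>2"
  have "cos_angle (ang pi) = - 1" "sin_angle (ang pi) = 0"
    by (transfer, simp)+
  with assms have ne: "\<not> (c = - 1 \<and> s = 0)"
    by (auto simp: c_def s_def angle_eq_iff)
  have D: "D \<noteq> 0"
  proof
    assume "D = 0"
    hence "(c + 1)\<^sup>2 = 0 \<and> s\<^sup>2 = 0"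
      unfolding D_def using zero_le_power2[of "c + 1"] zero_le_power2[of s] by linarith
    thus False using ne by (auto simp: add_eq_0_iff)
  qed
  have "(- (c + 1)\<^sup>2 + 4 * s\<^sup>2)\<^sup>2 + (4 * s * (c + 1))\<^sup>2 = D\<^sup>2"
    unfolding D_def by algebra
  hence "((- (c + 1)\<^sup>2 + 4 * s\<^sup>2) / D)\<^sup>2 + (4 * s * (c + 1) / D)\<^sup>2 = 1"
    using D by (simp add: power_divide flip: add_divide_distrib)
  then obtain t where
    t: "(- (c + 1)\<^sup>2 + 4 * s\<^sup>2) / D = cos t" "4 * s * (c + 1) / D = sin t"
    using sincos_total_2pi by metis
  have "cos_angle (ang t) = cos t" "sin_angle (ang t) = sin t"
    by (transfer, simp)+
  with t show ?thesis
    unfolding c_def [symmetric] s_def [symmetric] D_def [symmetric]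
    by (intro ex1I[of _ "ang t"]) (auto simp: angle_eq_iff)
qed

text \<open>
  The index type \<^typ>\<open>6\<close> is the ring of integers modulo 6, so that \<open>i + 1\<close>, \<open>i - 2\<close> etc.
  are taken modulo 6.
\<close>

type_synonym hexagon = "6 \<Rightarrow> real ^ 3"

definition vertex_angle :: "real ^ 3 \<Rightarrow> real ^ 3 \<Rightarrow> real ^ 3 \<Rightarrow> real" where
  "vertex_angle A B C = arccos (((A - B) \<bullet> (C - B)) / (norm (A - B) * norm (C - B)))"

definition equiangular_unit_hexagon :: "real \<Rightarrow> hexagon \<Rightarrow> bool" where
  "equiangular_unit_hexagon \<theta> P \<longleftrightarrow>
     (\<forall>i. dist (P i) (P (i + 1)) = 1) \<and>
     (\<forall>i. vertex_angle (P (i - 1)) (P i) (P (i + 1)) = \<theta>)"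

text \<open>
  In the next two definitions \<open>E\<close> is meant to be a plane; the vector \<open>n\<close> is one of its normals,
  and it may be replaced by its negative.
\<close>

definition strictly_same_side :: "(real ^ 3) set \<Rightarrow> real ^ 3 \<Rightarrow> real ^ 3 \<Rightarrow> bool" where
  "strictly_same_side E x y \<longleftrightarrow>
     (\<exists>n b. n \<noteq> 0 \<and> E = {z. n \<bullet> z = b} \<and> n \<bullet> x > b \<and> n \<bullet> y > b)"

definition strictly_opposite_sides :: "(real ^ 3) set \<Rightarrow> real ^ 3 \<Rightarrow> real ^ 3 \<Rightarrow> bool" where
  "strictly_opposite_sides E x y \<longleftrightarrow>
     (\<exists>n b. n \<noteq> 0 \<and> E = {z. n \<bullet> z = b} \<and> n \<bullet> x > b \<and> n \<bullet> y < b)"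

definition nondegenerate_parallelogram ::
    "real ^ 3 \<Rightarrow> real ^ 3 \<Rightarrow> real ^ 3 \<Rightarrow> real ^ 3 \<Rightarrow> bool" where
  "nondegenerate_parallelogram A B C D \<longleftrightarrow> D - A = C - B \<and> \<not> collinear {A, B, C, D}"

definition is_boat :: "hexagon \<Rightarrow> bool" where
  "is_boat P \<longleftrightarrow> (\<exists>\<theta>. equiangular_unit_hexagon \<theta> P) \<and>
     (\<exists>i. nondegenerate_parallelogram (P (i - 1)) (P (i + 1)) (P (i + 2)) (P (i - 2)) \<and>
          strictly_same_side (affine hull {P (i - 1), P (i + 1), P (i + 2), P (i - 2)})
            (P i) (P (i + 3)))"

definition is_chair :: "hexagon \<Rightarrow> bool" where
  "is_chair P \<longleftrightarrow> (\<exists>\<theta>. equiangular_unit_hexagon \<theta> P) \<and>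
     (\<exists>i. nondegenerate_parallelogram (P (i - 1)) (P (i + 1)) (P (i + 2)) (P (i - 2)) \<and>
          strictly_opposite_sides (affine hull {P (i - 1), P (i + 1), P (i + 2), P (i - 2)})
            (P i) (P (i + 3)))"

definition param_hexagon :: "angle \<Rightarrow> angle \<Rightarrow> angle \<Rightarrow> hexagon" where
  "param_hexagon \<phi>1 \<phi>3 \<phi>5 =
     (let C = cos (pi / 6); S = sin (pi / 6) in
      (\<lambda>i. if i = 0 then vector [- S, 0, 0]
           else if i = 1 then vector [0, - C * cos_angle \<phi>1, C * sin_angle \<phi>1]
           else if i = 2 then vector [S, 0, 0]
           else if i = 3 then vector
             [1 / 2 * S + sqrt 3 / 2 * C * cos_angle \<phi>3,
              sqrt 3 / 2 * S + 1 / 2 * C * cos_angle \<phi>3,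
              C * sin_angle \<phi>3]
           else if i = 4 then vector [0, sqrt 3 * S, 0]
           else vector
             [- (1 / 2) * S - sqrt 3 / 2 * C * cos_angle \<phi>5,
              sqrt 3 / 2 * S + 1 / 2 * C * cos_angle \<phi>5,
              C * sin_angle \<phi>5]))"

end

theory Submission
  imports Defs
begin

text \<open>
  The triangle \<open>P\<^sub>0P\<^sub>2P\<^sub>4\<close> is equilateral with unit sides, so the edge lengths and the angles at
  odd vertices are automatic. The angle at an even vertex is \<open>\<pi>/3\<close> iff the two adjacent parameters
  satisfy \<open>(1 + cos \<phi>) (1 + cos \<psi>) = 2 sin \<phi> sin \<psi>\<close>. This holds trivially if one of them is \<open>\<pi>\<close>, and
  otherwise determines \<open>\<psi>\<close> as \<open>f(\<phi>)\<close>. If none of the three parameters is \<open>\<pi>\<close>, they are therefore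
  all equal, and the relation forces \<open>cos \<phi> = 1/3\<close>.
\<close>

section \<open>Angles modulo 2 pi and the relation between neighbouring parameters\<close>

lemma cos_angle_ang [simp]: "cos_angle (ang x) = cos x"
  by transfer simp

lemma sin_angle_ang [simp]: "sin_angle (ang x) = sin x"
  by transfer simp

lemma cos_angle_squared_add: "(cos_angle \<phi>)\<^sup>2 + (sin_angle \<phi>)\<^sup>2 = 1"
  by transfer simp

lemma angle_eq_pi_iff: "\<phi> = ang pi \<longleftrightarrow> cos_angle \<phi> = - 1"
  using cos_angle_squared_add[of \<phi>] by (auto simp: angle_eq_iff)

text \<open>Away from \<open>\<pi>\<close>, compatibility reads \<open>2 tan (\<phi>/2) tan (\<psi>/2) = 1\<close>.\<close>

definition compatible :: "angle \<Rightarrow> angle \<Rightarrow> bool" where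
  "compatible \<phi> \<psi> \<longleftrightarrow> (1 + cos_angle \<phi>) * (1 + cos_angle \<psi>) = 2 * sin_angle \<phi> * sin_angle \<psi>"

lemma compatible_sym: "compatible \<phi> \<psi> \<longleftrightarrow> compatible \<psi> \<phi>"
  by (auto simp: compatible_def algebra_simps)

lemma compatible_pi [simp]: "compatible (ang pi) \<psi>" "compatible \<psi> (ang pi)"
  by (auto simp: compatible_def)

lemma f_angle_cos_sin:
  assumes "\<phi> \<noteq> ang pi"
  shows "cos_angle (f_angle \<phi>) =
      (- (cos_angle \<phi> + 1)\<^sup>2 + 4 * (sin_angle \<phi>)\<^sup>2) / ((cos_angle \<phi> + 1)\<^sup>2 + 4 * (sin_angle \<phi>)\<^sup>2)"
    and "sin_angle (f_angle \<phi>) =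
      4 * sin_angle \<phi> * (cos_angle \<phi> + 1) / ((cos_angle \<phi> + 1)\<^sup>2 + 4 * (sin_angle \<phi>)\<^sup>2)"
  using theI'[OF f_angle_unique_existence[OF assms]] assms
  unfolding f_angle_def by simp_all

text \<open>Away from \<pi>, 1 + cos f(\<phi>) = 8 s^2 / D in the notation of the proof, so both
  sides of the relation equal 8 s^2 (c + 1) / D.\<close>

lemma compatible_f_angle: "compatible \<phi> (f_angle \<phi>)"
proof (cases "\<phi> = ang pi")
  case False
  define c s where "c = cos_angle \<phi>" and "s = sin_angle \<phi>"
  define D where "D = (c + 1)\<^sup>2 + 4 * s\<^sup>2"
  have "c + 1 \<noteq> 0"
    using False by (auto simp: angle_eq_pi_iff c_def)
  then have "D > 0"
    unfolding D_def by (simp add: add_pos_nonneg)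
  then have "(1 + c) * (1 + (- (c + 1)\<^sup>2 + 4 * s\<^sup>2) / D) = 2 * s * (4 * s * (c + 1) / D)"
    by (simp add: field_simps) (simp add: D_def algebra_simps power2_eq_square)
  then show ?thesis
    unfolding compatible_def f_angle_cos_sin[OF False] by (simp add: c_def s_def D_def)
qed simp

text \<open>The relation with \<phi> fixes the ratio sin \<psi> / (1 + cos \<psi>) = tan (\<psi>/2),
  and this determines every angle other than \<pi>.\<close>

lemma compatible_unique:
  assumes "\<phi> \<noteq> ang pi" "\<psi> \<noteq> ang pi" "\<psi>' \<noteq> ang pi"
    and "compatible \<phi> \<psi>" "compatible \<phi> \<psi>'"
  shows "\<psi> = \<psi>'"
proof -
  define x s where "x = 1 + cos_angle \<phi>" and "s = sin_angle \<phi>"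
  define y t where "y = 1 + cos_angle \<psi>" and "t = sin_angle \<psi>"
  define y' t' where "y' = 1 + cos_angle \<psi>'" and "t' = sin_angle \<psi>'"
  have nz: "x \<noteq> 0" "y \<noteq> 0" "y' \<noteq> 0"
    using assms(1-3) by (auto simp: angle_eq_pi_iff x_def y_def y'_def)
  have e: "x * y = 2 * s * t" "x * y' = 2 * s * t'"
    using assms(4,5) by (auto simp: compatible_def x_def s_def y_def t_def y'_def t'_def)
  then have "s \<noteq> 0"
    using nz by auto
  \<comment> \<open>The two half-angle tangents t / y and t' / y' are shown equal in
    cross-multiplied form.\<close>
  have "2 * s * (t * y') = x * y * y'"
    by (simp add: e)
  also have "\<dots> = x * y' * y"
    by (simp only: ac_simps)
  also have "\<dots> = 2 * s * (t' * y)"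
    by (simp add: e)
  finally have ty: "t * y' = t' * y"
    using \<open>s \<noteq> 0\<close> by simp
  \<comment> \<open>The unit circle in the shifted coordinate y = 1 + cos \<psi>. Squaring t / y =
    t' / y' then gives (2 - y) / y = (2 - y') / y', hence y = y'.\<close>
  have circ: "t\<^sup>2 = y * (2 - y)" "t'\<^sup>2 = y' * (2 - y')"
    using cos_angle_squared_add[of \<psi>] cos_angle_squared_add[of \<psi>']
    by (simp_all add: y_def t_def y'_def t'_def algebra_simps power2_eq_square)
  have "(y * y') * ((2 - y) * y') = (t * y')\<^sup>2"
    by (simp add: power_mult_distrib circ(1)) (simp add: power2_eq_square)
  also have "\<dots> = (y * y') * ((2 - y') * y)"
    by (simp add: ty power_mult_distrib circ(2)) (simp add: power2_eq_square)
  finally have "(y * y') * ((2 - y) * y') = (y * y') * ((2 - y') * y)" .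
  then have "y = y'"
    using nz by (simp add: algebra_simps)
  then show ?thesis
    using ty nz by (simp add: angle_eq_iff y_def y'_def t_def t'_def)
qed

lemma compatible_cases:
  assumes "compatible \<phi> \<psi>"
  shows "\<phi> = ang pi \<or> \<psi> = ang pi \<or> \<psi> = f_angle \<phi>"
proof (rule ccontr)
  assume neg: "\<not> ?thesis"
  define c s where "c = cos_angle \<phi>" and "s = sin_angle \<phi>"
  have c: "c + 1 \<noteq> 0"
    using neg by (auto simp: angle_eq_pi_iff c_def)
  \<comment> \<open>If s vanished, the relation would make one of the nonzero factors 1 + cos
    \<phi>, 1 + cos \<psi> zero. From s \<noteq> 0 it follows that f(\<phi>) is not \<pi>, as
    uniqueness requires.\<close>
  have "s \<noteq> 0"
    using assms neg by (auto simp: compatible_def s_def angle_eq_pi_iff add_eq_0_iff)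
  then have "(c + 1)\<^sup>2 + 4 * s\<^sup>2 > 0"
    by (simp add: add_nonneg_pos)
  with neg c \<open>s \<noteq> 0\<close> have "sin_angle (f_angle \<phi>) \<noteq> 0"
    by (simp add: f_angle_cos_sin c_def s_def)
  then have "f_angle \<phi> \<noteq> ang pi"
    by auto
  then show False
    using compatible_unique[of \<phi> \<psi> "f_angle \<phi>"] assms compatible_f_angle neg by auto
qed

section \<open>The angles with cosine 1/3\<close>

lemma cos_chair_angle: "s \<in> {1, - 1} \<Longrightarrow> cos (s * arccos (1 / 3)) = 1 / 3"
  by auto

lemma sin_chair_angle: "s \<in> {1, - 1} \<Longrightarrow> sin (s * arccos (1 / 3)) = s * sqrt (8 / 9)"
  by (auto simp: sin_arccos power2_eq_square)

lemma compatible_chair_angle: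
  "s \<in> {1, - 1} \<Longrightarrow> compatible (ang (s * arccos (1 / 3))) (ang (s * arccos (1 / 3)))"
  by (auto simp: compatible_def cos_chair_angle sin_chair_angle)

lemma compatible_triple:
  assumes "\<phi> \<noteq> ang pi" "\<psi> \<noteq> ang pi" "\<omega> \<noteq> ang pi"
    and "compatible \<phi> \<psi>" "compatible \<phi> \<omega>" "compatible \<psi> \<omega>"
  obtains s where "s \<in> {1, - 1}" "\<phi> = ang (s * arccos (1 / 3))" "\<psi> = \<phi>" "\<omega> = \<phi>"
proof -
  \<comment> \<open>Two angles compatible with a common third one coincide; this is used with \<phi>
    and then with \<psi> as the common one.\<close>
  have eq: "\<psi> = \<omega>" "\<phi> = \<omega>"
    using assms compatible_unique[of \<phi> \<psi> \<omega>] compatible_unique[of \<psi> \<phi> \<omega>] compatible_sym[of \<phi> \<psi>]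
    by simp_all
  define c s where "c = cos_angle \<phi>" and "s = sin_angle \<phi>"
  have c: "1 + c \<noteq> 0"
    using assms(1) by (auto simp: angle_eq_pi_iff c_def)
  have "(1 + c) * (1 + c) = 2 * s * s"
    using assms(4) eq by (simp add: compatible_def c_def s_def)
  moreover have circ: "c\<^sup>2 + s\<^sup>2 = 1"
    by (simp add: c_def s_def cos_angle_squared_add)
  \<comment> \<open>Obtained by substituting s^2 = (1 - c) (1 + c) into (1 + c)^2 = 2 s^2.\<close>
  ultimately have "(1 + c) * (3 * c - 1) = 0"
    by (simp add: algebra_simps power2_eq_square)
  then have c3: "c = 1 / 3"
    using c by simp
  then have "s\<^sup>2 = (sqrt (8 / 9))\<^sup>2"
    using circ by (simp add: c3 power_divide)
  then have "s = 1 * sqrt (8 / 9) \<or> s = (- 1) * sqrt (8 / 9)"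
    by (simp only: power2_eq_iff) simp
  then obtain u where u: "u \<in> {1, - 1}" "s = u * sqrt (8 / 9)"
    by blast
  have "\<phi> = ang (u * arccos (1 / 3))"
    unfolding angle_eq_iff cos_angle_ang sin_angle_ang cos_chair_angle[OF u(1)] sin_chair_angle[OF u(1)]
    using c3 u(2) by (simp only: c_def s_def)
  then show thesis
    using that eq u(1) by blast
qed

section \<open>Multisets and the classification of compatible triples\<close>

lemma pair_mset_eq_cases:
  assumes "{#a, b#} = {#x, y#}"
  shows "a = x \<and> b = y \<or> a = y \<and> b = x"
proof -
  have "a \<in># {#x, y#}"
    unfolding assms[symmetric] by simp
  then consider "a = x" | "a = y"
    by auto
  then show ?thesis
  proof cases
    case 1
    then show ?thesis
      using assms by simp
  next
    case 2
    then have "{#y, b#} = {#y, x#}"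
      using assms add_mset_commute[of x y] by simp
    then show ?thesis
      using 2 by simp
  qed
qed

text \<open>Turns an equation of multisets into the six possible assignments of values to the three
  odd vertices.\<close>

lemma triple_mset_eq_cases:
  assumes "{#a, b, c#} = {#x, y, z#}"
  shows "a = x \<and> b = y \<and> c = z \<or> a = x \<and> b = z \<and> c = y \<or> a = y \<and> b = x \<and> c = z \<or>
    a = y \<and> b = z \<and> c = x \<or> a = z \<and> b = x \<and> c = y \<or> a = z \<and> b = y \<and> c = x"
proof -
  have "a \<in># {#x, y, z#}"
    unfolding assms[symmetric] by simp
  then consider "a = x" | "a = y" | "a = z"
    by auto
  then show ?thesis
  proof cases
    case 1
    then have "{#b, c#} = {#y, z#}"
      using assms by simp
    from pair_mset_eq_cases[OF this] 1 show ?thesis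
      by blast
  next
    case 2
    then have "{#b, c#} = {#x, z#}"
      using assms add_mset_commute[of x y "{#z#}"] by simp
    from pair_mset_eq_cases[OF this] 2 show ?thesis
      by blast
  next
    case 3
    have rot: "{#x, y, z#} = {#z, x, y#}"
      using add_mset_commute[of x z "{#y#}"] by (simp only: add_mset_commute[of y z "{#}"])
    have "{#z, b, c#} = {#z, x, y#}"
      using assms unfolding 3 rot .
    then have "{#b, c#} = {#x, y#}"
      by (simp only: add_mset_add_mset_same_iff)
    from pair_mset_eq_cases[OF this] 3 show ?thesis
      by blast
  qed
qed

lemma compatible_triple_iff:
  "compatible a b \<and> compatible a c \<and> compatible b c \<longleftrightarrow>
     (\<exists>\<phi>. {#a, b, c#} = {#ang pi, \<phi>, f_angle \<phi>#}) \<or>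
     (\<exists>\<phi>. {#a, b, c#} = {#ang pi, ang pi, \<phi>#}) \<or>
     (\<exists>s\<in>{1, - 1}. {#a, b, c#} =
        {#ang (s * arccos (1 / 3)), ang (s * arccos (1 / 3)), ang (s * arccos (1 / 3))#})"
  (is "?L \<longleftrightarrow> ?R1 \<or> ?R2 \<or> ?R3")
proof
  assume L: ?L
  \<comment> \<open>A parameter \<pi> is compatible with everything, so only the relation between
    the other two restricts the triple.\<close>
  have one_pi: "(\<exists>\<phi>. {#ang pi, u, v#} = {#ang pi, \<phi>, f_angle \<phi>#}) \<or>
      (\<exists>\<phi>. {#ang pi, u, v#} = {#ang pi, ang pi, \<phi>#})" if "compatible u v" for u v
    using compatible_cases[OF that]
  proof (elim disjE)
    assume "v = ang pi"
    then show ?thesis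
      by (intro disjI2 exI[of _ u]) (simp add: add_mset_commute)
  qed auto
  consider "a = ang pi" | "b = ang pi" | "c = ang pi"
    | "a \<noteq> ang pi" "b \<noteq> ang pi" "c \<noteq> ang pi"
    by blast
  then show "?R1 \<or> ?R2 \<or> ?R3"
  proof cases
    case 1
    then show ?thesis
      unfolding 1 disj_assoc[symmetric] by (intro disjI1 one_pi) (use L in simp)
  next
    case 2
    then have eq: "{#a, b, c#} = {#ang pi, a, c#}"
      by (simp add: add_mset_commute)
    show ?thesis
      unfolding eq disj_assoc[symmetric] by (intro disjI1 one_pi) (use L in simp)
  next
    case 3
    then have eq: "{#a, b, c#} = {#ang pi, a, b#}"
      by (simp add: add_mset_commute)
    show ?thesis
      unfolding eq disj_assoc[symmetric] by (intro disjI1 one_pi) (use L in simp)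
  next
    case 4
    then show ?thesis
      using L by (elim conjE compatible_triple[of a b c]) auto
  qed
next
  assume "?R1 \<or> ?R2 \<or> ?R3"
  \<comment> \<open>Pairwise compatibility is symmetric, so it may be checked in the order in which
    each multiset is listed.\<close>
  moreover have ?L if "{#a, b, c#} = {#x, y, z#}" "compatible x y" "compatible x z" "compatible y z"
    for x y z
    using triple_mset_eq_cases[OF that(1)] that(2-4) compatible_sym[of y x]
      compatible_sym[of z x] compatible_sym[of z y] by auto
  ultimately show ?L
    by (elim disjE exE bexE) (simp_all add: compatible_f_angle compatible_chair_angle)
qed

section \<open>From equiangular hexagons to compatible parameters\<close>

lemma vertex_angle_eq_pi3_iff:
  assumes "dist A B = 1" "dist B C = 1"
  shows "vertex_angle A B C = pi / 3 \<longleftrightarrow> (A - B) \<bullet> (C - B) = 1 / 2"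
proof -
  have n: "norm (A - B) = 1" "norm (C - B) = 1"
    using assms by (auto simp: dist_norm norm_minus_commute)
  \<comment> \<open>The inner product lies in the range on which \<open>cos\<close> inverts
    \<open>arccos\<close>.\<close>
  then have "\<bar>(A - B) \<bullet> (C - B)\<bar> \<le> 1"
    using Cauchy_Schwarz_ineq2[of "A - B" "C - B"] by simp
  then have "(A - B) \<bullet> (C - B) = cos (arccos ((A - B) \<bullet> (C - B)))"
    by (simp add: cos_arccos_abs)
  moreover have "arccos (1 / 2) = pi / 3"
    using arccos_cos[of "pi / 3"] by (simp add: cos_60)
  ultimately have "arccos ((A - B) \<bullet> (C - B)) = pi / 3 \<longleftrightarrow> (A - B) \<bullet> (C - B) = 1 / 2"
    using cos_60 by metis
  then show ?thesis
    by (simp add: vertex_angle_def n)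
qed

lemma mod6_arith: "(- 1::6) = 5" "(6::6) = 0" "(7::6) = 1" "(8::6) = 2"
  by simp_all

lemma forall_6: "(\<forall>i::6. Q i) \<longleftrightarrow> Q 0 \<and> Q 1 \<and> Q 2 \<and> Q 3 \<and> Q 4 \<and> Q 5"
proof -
  have "i \<in> {0, 1, 2, 3, 4, 5}" for i :: 6
  proof (cases i rule: bit0_cases)
    case (of_int z)
    then have "z \<in> {0, 1, 2, 3, 4, 5}"
      by auto
    then show ?thesis
      using of_int by auto
  qed
  then show ?thesis
    by (metis empty_iff insert_iff)
qed

lemma param_hexagon_simps:
  "param_hexagon \<phi>1 \<phi>3 \<phi>5 0 = vector [- (1 / 2), 0, 0]"
  "param_hexagon \<phi>1 \<phi>3 \<phi>5 1 =
     vector [0, - (sqrt 3 / 2) * cos_angle \<phi>1, sqrt 3 / 2 * sin_angle \<phi>1]"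
  "param_hexagon \<phi>1 \<phi>3 \<phi>5 2 = vector [1 / 2, 0, 0]"
  "param_hexagon \<phi>1 \<phi>3 \<phi>5 3 =
     vector [1 / 4 + 3 / 4 * cos_angle \<phi>3, sqrt 3 / 4 + sqrt 3 / 4 * cos_angle \<phi>3,
       sqrt 3 / 2 * sin_angle \<phi>3]"
  "param_hexagon \<phi>1 \<phi>3 \<phi>5 4 = vector [0, sqrt 3 / 2, 0]"
  "param_hexagon \<phi>1 \<phi>3 \<phi>5 5 =
     vector [- (1 / 4) - 3 / 4 * cos_angle \<phi>5, sqrt 3 / 4 + sqrt 3 / 4 * cos_angle \<phi>5,
       sqrt 3 / 2 * sin_angle \<phi>5]"
  by (simp_all add: param_hexagon_def cos_30 sin_30 Let_def vec_eq_iff forall_3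
      flip: mult.assoc)

lemma inner_vector_3_diff:
  fixes a b c :: real
  shows "(vector [a, b, c] - vector [a', b', c'] :: real ^ 3) \<bullet> (vector [x, y, z] - vector [x', y', z']) =
    (a - a') * (x - x') + (b - b') * (y - y') + (c - c') * (z - z')"
  by (simp add: inner_vec_def sum_3)

lemma dist_eq_1_iff:
  fixes x y :: "'a :: real_inner"
  shows "dist x y = 1 \<longleftrightarrow> (x - y) \<bullet> (x - y) = 1"
  by (simp add: dist_norm norm_eq_sqrt_inner)

text \<open>Each even vertex contributes one relation, between the parameters of its two odd
  neighbours: vertex 0 for \<phi>1 and \<phi>5, vertex 2 for \<phi>1 and \<phi>3, vertex 4 for
  \<phi>3 and \<phi>5.\<close>

lemma equiangular_param_hexagon_iff:
  "equiangular_unit_hexagon (pi / 3) (param_hexagon \<phi>1 \<phi>3 \<phi>5) \<longleftrightarrow>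
     compatible \<phi>1 \<phi>3 \<and> compatible \<phi>1 \<phi>5 \<and> compatible \<phi>3 \<phi>5"
proof -
  define P where "P = param_hexagon \<phi>1 \<phi>3 \<phi>5"
  define r where "r = sqrt 3"
  define c1 s1 c3 s3 c5 s5 where
    "c1 = cos_angle \<phi>1" and "s1 = sin_angle \<phi>1" and
    "c3 = cos_angle \<phi>3" and "s3 = sin_angle \<phi>3" and
    "c5 = cos_angle \<phi>5" and "s5 = sin_angle \<phi>5"
  note defs = c1_def s1_def c3_def s3_def c5_def s5_def
  \<comment> \<open>Reduction rules for squares of r and of the sines; the variants with a trailing
    x apply inside longer right-nested products.\<close>
  have r: "r * r = 3" "r * (r * x) = 3 * x" for x
    by (simp_all add: r_def flip: mult.assoc)
  have sq: "(sin_angle \<phi>)\<^sup>2 = 1 - (cos_angle \<phi>)\<^sup>2" for \<phi>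
    using cos_angle_squared_add[of \<phi>] by simp
  have circ: "s1 * (s1 * x) = (1 - c1 * c1) * x" "s1 * s1 = 1 - c1 * c1"
    "s3 * (s3 * x) = (1 - c3 * c3) * x" "s3 * s3 = 1 - c3 * c3"
    "s5 * (s5 * x) = (1 - c5 * c5) * x" "s5 * s5 = 1 - c5 * c5" for x
    by (simp_all add: defs sq flip: mult.assoc power2_eq_square)
  note P = param_hexagon_simps[of \<phi>1 \<phi>3 \<phi>5, folded P_def defs r_def]
  have dist: "dist (P 0) (P 1) = 1" "dist (P 1) (P 2) = 1" "dist (P 2) (P 3) = 1"
    "dist (P 3) (P 4) = 1" "dist (P 4) (P 5) = 1" "dist (P 5) (P 0) = 1"
    unfolding P dist_eq_1_iff inner_vector_3_diff by (simp_all add: field_simps r circ)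
  have odd: "(P 0 - P 1) \<bullet> (P 2 - P 1) = 1 / 2" "(P 2 - P 3) \<bullet> (P 4 - P 3) = 1 / 2"
    "(P 4 - P 5) \<bullet> (P 0 - P 5) = 1 / 2"
    unfolding P inner_vector_3_diff by (simp_all add: field_simps r circ)
  \<comment> \<open>The deviation from 1/2 = cos (\<pi>/3) is 3/8 times the difference of the two
    sides of the compatibility relation.\<close>
  have even:
    "(P 5 - P 0) \<bullet> (P 1 - P 0) = 1 / 2 + 3 / 8 * (2 * s1 * s5 - (1 + c1) * (1 + c5))"
    "(P 1 - P 2) \<bullet> (P 3 - P 2) = 1 / 2 + 3 / 8 * (2 * s1 * s3 - (1 + c1) * (1 + c3))"
    "(P 3 - P 4) \<bullet> (P 5 - P 4) = 1 / 2 + 3 / 8 * (2 * s3 * s5 - (1 + c3) * (1 + c5))"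
    unfolding P inner_vector_3_diff by (simp_all add: field_simps r circ)
  have "equiangular_unit_hexagon (pi / 3) P \<longleftrightarrow>
      (P 5 - P 0) \<bullet> (P 1 - P 0) = 1 / 2 \<and> (P 1 - P 2) \<bullet> (P 3 - P 2) = 1 / 2 \<and>
      (P 3 - P 4) \<bullet> (P 5 - P 4) = 1 / 2"
  proof -
    have "equiangular_unit_hexagon (pi / 3) P \<longleftrightarrow>
        vertex_angle (P 5) (P 0) (P 1) = pi / 3 \<and> vertex_angle (P 0) (P 1) (P 2) = pi / 3 \<and>
        vertex_angle (P 1) (P 2) (P 3) = pi / 3 \<and> vertex_angle (P 2) (P 3) (P 4) = pi / 3 \<and>
        vertex_angle (P 3) (P 4) (P 5) = pi / 3 \<and> vertex_angle (P 4) (P 5) (P 0) = pi / 3"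
      using dist by (simp add: equiangular_unit_hexagon_def forall_6 mod6_arith)
    then show ?thesis
      unfolding vertex_angle_eq_pi3_iff[OF dist(6) dist(1)] vertex_angle_eq_pi3_iff[OF dist(1,2)]
        vertex_angle_eq_pi3_iff[OF dist(2,3)] vertex_angle_eq_pi3_iff[OF dist(3,4)]
        vertex_angle_eq_pi3_iff[OF dist(4,5)] vertex_angle_eq_pi3_iff[OF dist(5,6)]
      using odd by simp
  qed
  also have "\<dots> \<longleftrightarrow> compatible \<phi>1 \<phi>5 \<and> compatible \<phi>1 \<phi>3 \<and> compatible \<phi>3 \<phi>5"
    unfolding even by (auto simp: compatible_def defs)
  finally show ?thesis
    by (auto simp: P_def)
qed

section \<open>Planes and their sides\<close>

text \<open>A dimension count: the hull lies in the plane, which has dimension 2, and the hull of a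
  non-collinear set has dimension at least 2.\<close>

lemma affine_hull_eq_plane:
  fixes S :: "(real ^ 3) set"
  assumes "\<not> collinear S" "n \<noteq> 0" "S \<subseteq> {z. n \<bullet> z = b}"
  shows "affine hull S = {z. n \<bullet> z = b}"
proof (rule affine_dim_equal)
  show le: "affine hull S \<subseteq> {z. n \<bullet> z = b}"
    using assms(3) by (simp add: affine_hyperplane hull_minimal)
  show "affine hull S \<noteq> {}"
    using assms(1) by auto
  have "aff_dim {z. n \<bullet> z = b} = 2"
    using assms(2) by (simp add: aff_dim_hyperplane)
  moreover have "aff_dim (affine hull S) \<ge> 2"
    using assms(1) by (simp add: collinear_aff_dim)
  ultimately show "aff_dim (affine hull S) = aff_dim {z. n \<bullet> z = b}"
    using aff_dim_subset[OF le] by simp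
qed (simp_all add: affine_hyperplane)

text \<open>The scalar triple product, six times the signed volume of the tetrahedron
  \<open>A B C x\<close>. Its sign tells on which side of the plane \<open>A B C\<close> the point
  \<open>x\<close> lies.\<close>

definition orient :: "real ^ 3 \<Rightarrow> real ^ 3 \<Rightarrow> real ^ 3 \<Rightarrow> real ^ 3 \<Rightarrow> real" where
  "orient A B C x = cross3 (B - A) (C - A) \<bullet> (x - A)"

lemma orient_vector:
  "orient (vector [a1, a2, a3]) (vector [b1, b2, b3]) (vector [c1, c2, c3]) (vector [x1, x2, x3]) =
    ((b2 - a2) * (c3 - a3) - (b3 - a3) * (c2 - a2)) * (x1 - a1) +
    ((b3 - a3) * (c1 - a1) - (b1 - a1) * (c3 - a3)) * (x2 - a2) +
    ((b1 - a1) * (c2 - a2) - (b2 - a2) * (c1 - a1)) * (x3 - a3)"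
  by (simp add: orient_def cross3_def inner_vec_def sum_3)

text \<open>A nonzero triple product forces \<open>A\<close>, \<open>B\<close>, \<open>C\<close> to
  be non-collinear, and \<open>D = A + C - B\<close> lies in their plane, so the sides of that plane
  are read off from the signs of \<open>orient\<close>.\<close>

lemma parallelogram_sides:
  assumes par: "D - A = C - B" and nz: "orient A B C x \<noteq> 0"
  shows "nondegenerate_parallelogram A B C D"
    and "orient A B C x * orient A B C y > 0 \<Longrightarrow> strictly_same_side (affine hull {A, B, C, D}) x y"
    and "orient A B C x * orient A B C y < 0 \<Longrightarrow> strictly_opposite_sides (affine hull {A, B, C, D}) x y"
proof -
  define m where "m = cross3 (B - A) (C - A)"
  have m: "m \<noteq> 0"
    using nz by (auto simp: orient_def m_def)
  then have "\<not> collinear {0, B - A, C - A}"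
    by (simp add: m_def cross_eq_0)
  then have "\<not> collinear {B, A, C}"
    by (subst collinear_3) (simp_all add: NO_MATCH_def)
  then have ncol: "\<not> collinear {A, B, C, D}"
    using collinear_subset[of "{A, B, C, D}" "{B, A, C}"] by auto
  then show "nondegenerate_parallelogram A B C D"
    using par by (simp add: nondegenerate_parallelogram_def)
  have mB: "m \<bullet> B = m \<bullet> A" and mC: "m \<bullet> C = m \<bullet> A"
    using dot_cross_self[of "B - A" "C - A"] by (simp_all add: m_def inner_diff_right)
  have "D = (D - A) + A"
    by simp
  also have "\<dots> = C - B + A"
    by (simp only: par)
  finally have mD: "m \<bullet> D = m \<bullet> A"
    using mB mC by (simp add: inner_add_right inner_diff_right)
  have plane: "affine hull {A, B, C, D} = {z. (k *\<^sub>R m) \<bullet> z = k * (m \<bullet> A)}" if "k \<noteq> 0" for k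
  proof (rule affine_hull_eq_plane[OF ncol])
    show "k *\<^sub>R m \<noteq> 0"
      using that m by simp
    show "{A, B, C, D} \<subseteq> {z. (k *\<^sub>R m) \<bullet> z = k * (m \<bullet> A)}"
      by (simp add: mB mC mD)
  qed
  have o: "orient A B C z = m \<bullet> z - m \<bullet> A" for z
    by (simp add: orient_def m_def inner_diff_right)
  \<comment> \<open>Both side predicates want \<open>x\<close> on the positive side of the normal,
    so the normal \<open>m\<close> is flipped if necessary.\<close>
  define k where "k = sgn (m \<bullet> x - m \<bullet> A)"
  have k: "k \<noteq> 0" "k *\<^sub>R m \<noteq> 0" "(k *\<^sub>R m) \<bullet> x > k * (m \<bullet> A)"
    using nz m by (auto simp: k_def o sgn_if)
  show "strictly_same_side (affine hull {A, B, C, D}) x y" if "orient A B C x * orient A B C y > 0"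
  proof -
    have "(k *\<^sub>R m) \<bullet> y > k * (m \<bullet> A)"
      using that by (auto simp: k_def o sgn_if zero_less_mult_iff)
    with k show ?thesis
      unfolding strictly_same_side_def plane[OF k(1)] by blast
  qed
  show "strictly_opposite_sides (affine hull {A, B, C, D}) x y" if "orient A B C x * orient A B C y < 0"
  proof -
    have "(k *\<^sub>R m) \<bullet> y < k * (m \<bullet> A)"
      using that by (auto simp: k_def o sgn_if mult_less_0_iff)
    with k show ?thesis
      unfolding strictly_opposite_sides_def plane[OF k(1)] by blast
  qed
qed

section \<open>Boats and chairs\<close>

text \<open>Reduces a boat to coordinate computations at a chosen \<open>i\<close>; the positive
  product also excludes a degenerate parallelogram.\<close>

lemma is_boatI:
  assumes "equiangular_unit_hexagon \<theta> P" "P (i - 2) - P (i - 1) = P (i + 2) - P (i + 1)"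
    and "orient (P (i - 1)) (P (i + 1)) (P (i + 2)) (P i) *
      orient (P (i - 1)) (P (i + 1)) (P (i + 2)) (P (i + 3)) > 0"
  shows "is_boat P"
proof -
  have nz: "orient (P (i - 1)) (P (i + 1)) (P (i + 2)) (P i) \<noteq> 0"
    using assms(3) by auto
  show ?thesis
    unfolding is_boat_def
    using assms(1) parallelogram_sides(1)[OF assms(2) nz] parallelogram_sides(2)[OF assms(2) nz assms(3)]
    by blast
qed

lemma is_chairI:
  assumes "equiangular_unit_hexagon \<theta> P" "P (i - 2) - P (i - 1) = P (i + 2) - P (i + 1)"
    and "orient (P (i - 1)) (P (i + 1)) (P (i + 2)) (P i) *
      orient (P (i - 1)) (P (i + 1)) (P (i + 2)) (P (i + 3)) < 0"
  shows "is_chair P"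
proof -
  have nz: "orient (P (i - 1)) (P (i + 1)) (P (i + 2)) (P i) \<noteq> 0"
    using assms(3) by auto
  show ?thesis
    unfolding is_chair_def
    using assms(1) parallelogram_sides(1)[OF assms(2) nz] parallelogram_sides(3)[OF assms(2) nz assms(3)]
    by blast
qed

lemma vector_3_diff_eq:
  fixes a b c :: real
  shows "(vector [a, b, c] - vector [a', b', c'] :: real ^ 3) = vector [x, y, z] - vector [x', y', z'] \<longleftrightarrow>
    a - a' = x - x' \<and> b - b' = y - y' \<and> c - c' = z - z'"
  by (simp add: vec_eq_iff forall_3)

text \<open>The parameter \<pi> at an odd vertex \<open>i\<close> makes \<open>P i\<close> coincide
  with the opposite vertex \<open>P (i + 3)\<close>, so the product of the two orientations is a
  square, nonzero because sin \<alpha> \<noteq> 0. The value cos \<alpha> = 1/3 at the other two odd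
  vertices gives the parallelogram.\<close>

lemma boat_param_hexagon:
  assumes eq: "equiangular_unit_hexagon (pi / 3) (param_hexagon \<phi>1 \<phi>3 \<phi>5)"
    and \<alpha>: "cos_angle \<alpha> = 1 / 3" "(sin_angle \<alpha>)\<^sup>2 = 8 / 9"
    and "\<phi>1 = ang pi \<and> \<phi>3 = \<alpha> \<and> \<phi>5 = \<alpha> \<or> \<phi>1 = \<alpha> \<and> \<phi>3 = ang pi \<and> \<phi>5 = \<alpha> \<or>
      \<phi>1 = \<alpha> \<and> \<phi>3 = \<alpha> \<and> \<phi>5 = ang pi"
  shows "is_boat (param_hexagon \<phi>1 \<phi>3 \<phi>5)"
proof -
  define r where "r = sqrt 3"
  define s where "s = sin_angle \<alpha>"
  have r: "r > 0"
    by (simp add: r_def)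
  have s: "s \<noteq> 0"
    using \<alpha> by (auto simp: s_def)
  show ?thesis
    using assms(4)
  proof (elim disjE conjE)
    assume "\<phi>1 = ang pi" "\<phi>3 = \<alpha>" "\<phi>5 = \<alpha>"
    then show ?thesis
      using r s
      by (intro is_boatI[OF eq, of 1])
        (auto simp: mod6_arith param_hexagon_simps orient_vector vector_3_diff_eq \<alpha>
          zero_less_mult_iff mult_less_0_iff linorder_neq_iff simp flip: s_def r_def)
  next
    assume "\<phi>1 = \<alpha>" "\<phi>3 = ang pi" "\<phi>5 = \<alpha>"
    then show ?thesis
      using r s
      by (intro is_boatI[OF eq, of 3])
        (auto simp: mod6_arith param_hexagon_simps orient_vector vector_3_diff_eq \<alpha>
          zero_less_mult_iff mult_less_0_iff linorder_neq_iff simp flip: s_def r_def)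
  next
    assume "\<phi>1 = \<alpha>" "\<phi>3 = \<alpha>" "\<phi>5 = ang pi"
    then show ?thesis
      using r s
      by (intro is_boatI[OF eq, of 5])
        (auto simp: mod6_arith param_hexagon_simps orient_vector vector_3_diff_eq \<alpha>
          zero_less_mult_iff mult_less_0_iff linorder_neq_iff simp flip: s_def r_def)
  qed
qed

text \<open>The vertices 0, 2, 3, 5 form the same parallelogram as in the boat with \<phi>1 = \<pi>,
  but the parameter \<alpha> puts vertex 1 across the plane from vertex 4: the two orientations are
  3/4 sin \<alpha> and -3/4 sin \<alpha>.\<close>

lemma chair_param_hexagon:
  assumes eq: "equiangular_unit_hexagon (pi / 3) (param_hexagon \<alpha> \<alpha> \<alpha>)"
    and \<alpha>: "cos_angle \<alpha> = 1 / 3" "(sin_angle \<alpha>)\<^sup>2 = 8 / 9"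
  shows "is_chair (param_hexagon \<alpha> \<alpha> \<alpha>)"
proof -
  define r where "r = sqrt 3"
  define s where "s = sin_angle \<alpha>"
  have r: "r > 0"
    by (simp add: r_def)
  have s: "s \<noteq> 0"
    using \<alpha> by (auto simp: s_def)
  show ?thesis
    using r s
    by (intro is_chairI[OF eq, of 1])
      (auto simp: mod6_arith param_hexagon_simps orient_vector vector_3_diff_eq \<alpha>
        zero_less_mult_iff mult_less_0_iff linorder_neq_iff simp flip: s_def r_def)
qed

text \<open>A self-compatible angle other than \<pi> is a fixed point of f. This places the boat
  triple {\<pi>, \<alpha>, \<alpha>} in the first family.\<close>

lemma f_angle_chair_angle:
  assumes "cos_angle \<alpha> = 1 / 3" "compatible \<alpha> \<alpha>"
  shows "f_angle \<alpha> = \<alpha>"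
  using compatible_cases[OF assms(2)] assms(1) by (auto simp: angle_eq_pi_iff)

text \<open>The first conjunct is an equivalence because every value of \<phi> is claimed to occur.
  A single \<open>s\<close> gives all entries of a triple the same sign.\<close>

theorem theorem3p4:
  fixes \<phi>1 \<phi>3 \<phi>5 :: angle
  shows
    "(equiangular_unit_hexagon (pi / 3) (param_hexagon \<phi>1 \<phi>3 \<phi>5) \<longleftrightarrow>
        (\<exists>\<phi>. {#\<phi>1, \<phi>3, \<phi>5#} = {#ang pi, \<phi>, f_angle \<phi>#}) \<or>
        (\<exists>\<phi>. {#\<phi>1, \<phi>3, \<phi>5#} = {#ang pi, ang pi, \<phi>#}) \<or>
        (\<exists>s\<in>{1, - 1}. {#\<phi>1, \<phi>3, \<phi>5#} =
           {#ang (s * arccos (1 / 3)), ang (s * arccos (1 / 3)), ang (s * arccos (1 / 3))#})) \<and>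
     (\<forall>s\<in>{1, - 1}.
        {#\<phi>1, \<phi>3, \<phi>5#} = {#ang pi, ang (s * arccos (1 / 3)), ang (s * arccos (1 / 3))#} \<longrightarrow>
        (\<exists>\<phi>. {#\<phi>1, \<phi>3, \<phi>5#} = {#ang pi, \<phi>, f_angle \<phi>#}) \<and>
        is_boat (param_hexagon \<phi>1 \<phi>3 \<phi>5)) \<and>
     (\<forall>s\<in>{1, - 1}.
        {#\<phi>1, \<phi>3, \<phi>5#} =
          {#ang (s * arccos (1 / 3)), ang (s * arccos (1 / 3)), ang (s * arccos (1 / 3))#} \<longrightarrow>
        is_chair (param_hexagon \<phi>1 \<phi>3 \<phi>5))"
proof (intro conjI ballI impI)
  show "equiangular_unit_hexagon (pi / 3) (param_hexagon \<phi>1 \<phi>3 \<phi>5) \<longleftrightarrow>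
        (\<exists>\<phi>. {#\<phi>1, \<phi>3, \<phi>5#} = {#ang pi, \<phi>, f_angle \<phi>#}) \<or>
        (\<exists>\<phi>. {#\<phi>1, \<phi>3, \<phi>5#} = {#ang pi, ang pi, \<phi>#}) \<or>
        (\<exists>s\<in>{1, - 1}. {#\<phi>1, \<phi>3, \<phi>5#} =
           {#ang (s * arccos (1 / 3)), ang (s * arccos (1 / 3)), ang (s * arccos (1 / 3))#})"
    unfolding equiangular_param_hexagon_iff compatible_triple_iff ..
next
  fix s :: real
  assume s: "s \<in> {1, - 1}"
  define \<alpha> where "\<alpha> = ang (s * arccos (1 / 3))"
  have \<alpha>: "cos_angle \<alpha> = 1 / 3" "(sin_angle \<alpha>)\<^sup>2 = 8 / 9" "compatible \<alpha> \<alpha>"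
    using s by (auto simp: \<alpha>_def cos_chair_angle sin_chair_angle compatible_chair_angle)
  {
    assume "{#\<phi>1, \<phi>3, \<phi>5#} = {#ang pi, ang (s * arccos (1 / 3)), ang (s * arccos (1 / 3))#}"
    then have m: "{#\<phi>1, \<phi>3, \<phi>5#} = {#ang pi, \<alpha>, \<alpha>#}"
      by (simp add: \<alpha>_def)
    show "\<exists>\<phi>. {#\<phi>1, \<phi>3, \<phi>5#} = {#ang pi, \<phi>, f_angle \<phi>#}"
      using m f_angle_chair_angle[OF \<alpha>(1,3)] by (intro exI[of _ \<alpha>]) simp
    \<comment> \<open>Membership in the first family supplies the equiangularity that a boat
      requires.\<close>
    then have "equiangular_unit_hexagon (pi / 3) (param_hexagon \<phi>1 \<phi>3 \<phi>5)"
      unfolding equiangular_param_hexagon_iff compatible_triple_iff by blast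
    then show "is_boat (param_hexagon \<phi>1 \<phi>3 \<phi>5)"
      by (rule boat_param_hexagon[OF _ \<alpha>(1,2)]) (use triple_mset_eq_cases[OF m] in blast)
  next
    assume "{#\<phi>1, \<phi>3, \<phi>5#} =
      {#ang (s * arccos (1 / 3)), ang (s * arccos (1 / 3)), ang (s * arccos (1 / 3))#}"
    from triple_mset_eq_cases[OF this] have "\<phi>1 = \<alpha>" "\<phi>3 = \<alpha>" "\<phi>5 = \<alpha>"
      by (simp_all add: \<alpha>_def)
    then show "is_chair (param_hexagon \<phi>1 \<phi>3 \<phi>5)"
      using chair_param_hexagon[OF _ \<alpha>(1,2)] \<alpha>(3)
      by (simp add: equiangular_param_hexagon_iff)
  }
qed

end
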